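(* Let $n\ge1$, $0<\epsilon\le n+1$, $\beta=0.414213$, $\eta=\beta/\sqrt{n+1}$, $\gamma=1-\eta$, and $$\mathcal N=\left\lceil\frac{\log\!\big(\frac{n+1}{\epsilon}\big)}{-\log\!\big(1-\frac{0.414213}{\sqrt{n+1}}\big)}\right\rceil.$$ Run Algorithm A for $\mathcal N$ iterations. Then for every $k=0,1,\dots,\mathcal N$ the iterates are well defined, $\bar x^k>0$, $\bar s^k>0$, $\|\bar x^k\odot\bar s^k-\bar\mu^k e\|\le\beta\bar\mu^k$, and $$\bar r^k=(1-\eta)^k\bar r^0,\qquad (\bar x^k)^\top\bar s^k=(1-\eta)^k(n+1).$$ In particular, after exactly $\mathcal N$ iterations, $\|\bar r^{\mathcal N}\|\le\epsilon$ and $(\bar x^{\mathcal N})^\top\bar s^{\mathcal N}\le\epsilon$, i.e. $(\bar x^{\mathcal N},\bar s^{\mathcal N})$ is an $\epsilon$-approximate maximal complementary solution of the homogeneous LCP.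
   Context: Let $Q\in\mathbb{R}^{n_z\times n_z}$ be symmetric positive semidefinite, $c\in\mathbb{R}^{n_z}$, $A\in\mathbb{R}^{n_b\times n_z}$, $b\in\mathbb{R}^{n_b}$, and $n=n_z+n_b$. Define $M=\begin{bmatrix}Q&-A^\top\\ A&0\end{bmatrix}$ and $q=\begin{bmatrix}c\\-b\end{bmatrix}$. For a matrix $M'$ and vector $q'$ and $\bar x=(x,\tau)\in\mathbb{R}^{n+1}_{++}$, write $\psi(\bar x)=\begin{bmatrix} M'x+q'\tau\\ -x^\top M'x/\tau-x^\top q'\end{bmatrix}$ with Jacobian $\nabla\psi(\bar x)=\begin{bmatrix} M' & q'\\ -x^\top(M'+M'^\top)/\tau-q'^\top & x^\top M'x/\tau^2\end{bmatrix}$. $\odot$ is componentwise product, $e$ the all-ones vector, $\|\cdot\|$ the Euclidean norm. Algorithm A: (1) Let $\sigma=\max\{1,\max_i(Me+q)_i,-e^\top Me-e^\top q\}$ and set $M'=M/\sigma$, $q'=q/\sigma$ (used in $\psi$ henceforth). (2) Set $\bar x^0=e\in\mathbb{R}^{n+1}$, $\bar s^0=e\in\mathbb{R}^{n+1}$. (3) For $k=0,1,\dots$: set $\bar r^k=\bar s^k-\psi(\bar x^k)$, $\bar\mu^k=(\bar x^k)^\top\bar s^k/(n+1)$; compute $(d_{\bar x},d_{\bar s})$ solving $d_{\bar s}-\nabla\psi(\bar x^k)d_{\bar x}=-\eta\bar r^k$ and $\bar x^k\odot d_{\bar s}+\bar s^k\odot d_{\bar x}=\gamma\bar\mu^k e-\bar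 x^k\odot\bar s^k$; set $\bar x^{k+1}=\bar x^k+d_{\bar x}$ and $\bar s^{k+1}=\psi(\bar x^{k+1})+\gamma\bar r^k$. An $\epsilon$-approximate maximal complementary solution means $\bar x,\bar s>0$ with $\|\bar s-\psi(\bar x)\|\le\epsilon$ and $\bar x^\top\bar s\le\epsilon$. *)

theory Defs
  imports Complex_Main "Jordan_Normal_Form.Matrix"
begin

text \<open>Vectors in R^m are rendered as JNF vectors of dimension m.
  The extended vector xbar = (x, tau) in R^(n+1) has x = first n entries, tau = entry n.\<close>

definition ones :: "nat \<Rightarrow> real vec" where
  "ones m = vec m (\<lambda>_. 1)"

definition hadamard :: "real vec \<Rightarrow> real vec \<Rightarrow> real vec" where
  "hadamard v w = vec (dim_vec v) (\<lambda>i. v $ i * w $ i)"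

definition vnorm :: "real vec \<Rightarrow> real" where
  "vnorm v = sqrt (v \<bullet> v)"

definition pos_vec :: "real vec \<Rightarrow> bool" where
  "pos_vec v \<longleftrightarrow> (\<forall>i<dim_vec v. v $ i > 0)"

definition lcp_M :: "real mat \<Rightarrow> real mat \<Rightarrow> nat \<Rightarrow> real mat" where
  "lcp_M Q A nb = four_block_mat Q (- (A\<^sup>T)) A (0\<^sub>m nb nb)"

definition lcp_q :: "real vec \<Rightarrow> real vec \<Rightarrow> real vec" where
  "lcp_q c b = c @\<^sub>v (- b)"

definition scale_sigma :: "real mat \<Rightarrow> real vec \<Rightarrow> nat \<Rightarrow> real" where
  "scale_sigma M q n = max 1 (max (Max {(M *\<^sub>v ones n + q) $ i | i. i < n})
      (- (ones n \<bullet> (M *\<^sub>v ones n)) - ones n \<bullet> q))"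

definition xpart :: "nat \<Rightarrow> real vec \<Rightarrow> real vec" where
  "xpart n xb = vec n (\<lambda>i. xb $ i)"

definition taupart :: "nat \<Rightarrow> real vec \<Rightarrow> real" where
  "taupart n xb = xb $ n"

definition psi :: "real mat \<Rightarrow> real vec \<Rightarrow> nat \<Rightarrow> real vec \<Rightarrow> real vec" where
  "psi Mp qp n xb =
     (let x = xpart n xb; \<tau> = taupart n xb in
      (Mp *\<^sub>v x + \<tau> \<cdot>\<^sub>v qp) @\<^sub>v vec 1 (\<lambda>_. - (x \<bullet> (Mp *\<^sub>v x)) / \<tau> - x \<bullet> qp))"

text \<open>Jacobian [[M', q'],[-x^T(M'+M'^T)/tau - q'^T, x^T M' x / tau^2]]; the row vector
  x^T(M'+M'^T) is written as the column vector (M'+M'^T)^T x.\<close>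
definition jac :: "real mat \<Rightarrow> real vec \<Rightarrow> nat \<Rightarrow> real vec \<Rightarrow> real mat" where
  "jac Mp qp n xb =
     (let x = xpart n xb; \<tau> = taupart n xb in
      four_block_mat Mp (mat_of_cols n [qp])
        (mat_of_rows n [(- (1 / \<tau>)) \<cdot>\<^sub>v ((Mp + Mp\<^sup>T)\<^sup>T *\<^sub>v x) - qp])
        (mat 1 1 (\<lambda>_. (x \<bullet> (Mp *\<^sub>v x)) / \<tau>\<^sup>2)))"

definition resid :: "real mat \<Rightarrow> real vec \<Rightarrow> nat \<Rightarrow> real vec \<Rightarrow> real vec \<Rightarrow> real vec" where
  "resid Mp qp n xb sb = sb - psi Mp qp n xb"

definition mu_bar :: "nat \<Rightarrow> real vec \<Rightarrow> real vec \<Rightarrow> real" where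
  "mu_bar n xb sb = (xb \<bullet> sb) / (real n + 1)"

definition newton_sol ::
  "real mat \<Rightarrow> real vec \<Rightarrow> nat \<Rightarrow> real \<Rightarrow> real \<Rightarrow> real vec \<Rightarrow> real vec \<Rightarrow> real vec \<times> real vec \<Rightarrow> bool" where
  "newton_sol Mp qp n \<eta> \<gamma> xb sb d \<longleftrightarrow>
     fst d \<in> carrier_vec (n + 1) \<and> snd d \<in> carrier_vec (n + 1) \<and>
     snd d - jac Mp qp n xb *\<^sub>v fst d = - (\<eta> \<cdot>\<^sub>v resid Mp qp n xb sb) \<and>
     hadamard xb (snd d) + hadamard sb (fst d)
       = (\<gamma> * mu_bar n xb sb) \<cdot>\<^sub>v ones (n + 1) - hadamard xb sb"

definition algA_step ::
  "real mat \<Rightarrow> real vec \<Rightarrow> nat \<Rightarrow> real \<Rightarrow> real \<Rightarrow> real vec \<times> real vec \<Rightarrow> real vec \<times> real vec" where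
  "algA_step Mp qp n \<eta> \<gamma> st =
     (let xb = fst st; sb = snd st;
          d = (THE d. newton_sol Mp qp n \<eta> \<gamma> xb sb d);
          xb' = xb + fst d
      in (xb', psi Mp qp n xb' + \<gamma> \<cdot>\<^sub>v resid Mp qp n xb sb))"

text \<open>Iterates of Algorithm A with the scaled data M' = M/sigma, q' = q/sigma.\<close>
fun algA_iter ::
  "real mat \<Rightarrow> real vec \<Rightarrow> nat \<Rightarrow> real \<Rightarrow> real \<Rightarrow> nat \<Rightarrow> real vec \<times> real vec" where
  "algA_iter Mp qp n \<eta> \<gamma> 0 = (ones (n + 1), ones (n + 1))"
| "algA_iter Mp qp n \<eta> \<gamma> (Suc k) = algA_step Mp qp n \<eta> \<gamma> (algA_iter Mp qp n \<eta> \<gamma> k)"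

end

theory Submission
  imports Defs "Jordan_Normal_Form.Determinant"
begin

text \<open>
  Since \<open>x \<bullet> \<psi>(x) = 0\<close> and \<open>\<nabla>\<psi>(x)\<^sup>T x = -\<psi>(x)\<close>, the choice \<open>\<gamma> = 1 - \<eta>\<close>
  makes the Newton direction \<open>d\<^sub>x\<close> orthogonal to the residual. Hence \<open>W = d\<^sub>x \<bullet> d\<^sub>s\<close> equals
  \<open>d\<^sub>x \<bullet> \<nabla>\<psi>(x) d\<^sub>x\<close>, which is nonnegative. The linearisation error of \<open>\<psi>\<close> sits in the
  last coordinate alone and is exactly \<open>-W / (\<tau> + d\<^sub>\<tau>)\<close>, so the new complementarity products are
  \<open>\<gamma>\<mu>e + d\<^sub>x \<odot> d\<^sub>s - W e\<^sub>n\<^sub>+\<^sub>1\<close>. The perturbation of \<open>\<gamma>\<mu>e\<close> has entries summing to zero, and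
  its positive part is at most a quarter of \<open>\<Sum>\<^sub>i (\<gamma>\<mu> - x\<^sub>i s\<^sub>i)\<^sup>2 / (x\<^sub>i s\<^sub>i) \<le> 2\<beta>\<^sup>2\<mu> / (1 - \<beta>)\<close>; this
  keeps the iterates in the neighbourhood. The same sum bounds \<open>(d\<^sub>x\<^sub>i / x\<^sub>i)\<^sup>2\<close> by
  \<open>2\<beta>\<^sup>2 / (1 - \<beta>)\<^sup>2\<close>, which is below \<open>1\<close> exactly when \<open>\<beta> < \<surd>2 - 1\<close>, so \<open>x\<close> stays positive.
  Finally, the scaling by \<open>\<sigma>\<close> gives \<open>r\<^sup>0 \<ge> 0\<close>, and \<open>e \<bullet> r\<^sup>0 = n + 1\<close>, whence \<open>\<parallel>r\<^sup>0\<parallel> \<le> n + 1\<close>.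
\<close>

section \<open>Splitting vectors at the last coordinate\<close>

lemma xpart_carrier [simp]: "xpart n v \<in> carrier_vec n" "dim_vec (xpart n v) = n"
  by (auto simp: xpart_def)

lemma scalar_prod_split_last:
  assumes "u \<in> carrier_vec (n + 1)" "v \<in> carrier_vec (n + 1)"
  shows "u \<bullet> v = xpart n u \<bullet> xpart n v + u $ n * v $ n"
  using assms by (simp add: scalar_prod_def xpart_def)

lemma scalar_prod_sum:
  "dim_vec v = m \<Longrightarrow> u \<bullet> v = (\<Sum>i<m. u $ i * v $ i)"
  by (simp add: scalar_prod_def lessThan_atLeast0)

lemma xpart_append_last:
  assumes "v \<in> carrier_vec (n + 1)"
  shows "v = xpart n v @\<^sub>v vec 1 (\<lambda>_. v $ n)"
  using assms by (intro eq_vecI) (auto simp: xpart_def less_Suc_eq)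

lemma smult_mat_mult_vec:
  fixes M :: "'a::comm_ring_1 mat"
  assumes "M \<in> carrier_mat m n" "v \<in> carrier_vec n"
  shows "(a \<cdot>\<^sub>m M) *\<^sub>v v = a \<cdot>\<^sub>v (M *\<^sub>v v)"
  using assms by (intro eq_vecI) (auto simp: scalar_prod_def sum_distrib_left mult.assoc)

section \<open>The homogeneous map \<open>psi\<close> and its Jacobian\<close>

text \<open>\<open>M\<close> and \<open>q\<close> play the role of the scaled data. Monotonicity is
  stated through the quadratic form because the matrix of the complementarity problem has skew
  off-diagonal blocks.\<close>

locale monotone_lcp =
  fixes M :: "real mat" and q :: "real vec" and n :: nat
  assumes M_carrier [simp]: "M \<in> carrier_mat n n"
    and q_carrier [simp]: "q \<in> carrier_vec n"
    and M_psd: "\<And>v. v \<in> carrier_vec n \<Longrightarrow> v \<bullet> (M *\<^sub>v v) \<ge> 0"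
begin

lemma M_dim [simp]: "dim_row M = n" "dim_col M = n" "dim_vec q = n"
  using M_carrier q_carrier by (blast dest: carrier_matD carrier_vecD)+

lemma psi_carrier [simp]: "psi M q n v \<in> carrier_vec (n + 1)"
  by (rule carrier_vecI) (simp add: psi_def Let_def)

lemma psi_dim [simp]: "dim_vec (psi M q n v) = n + 1"
  using psi_carrier by (rule carrier_vecD)

lemma psi_index_less:
  "i < n \<Longrightarrow> psi M q n v $ i = (M *\<^sub>v xpart n v) $ i + v $ n * q $ i"
  by (simp add: psi_def Let_def taupart_def)

lemma xpart_psi: "xpart n (psi M q n v) = M *\<^sub>v xpart n v + v $ n \<cdot>\<^sub>v q"
  by (intro eq_vecI) (auto simp: psi_index_less xpart_def[of n "psi M q n v"])

lemma psi_index_last: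
  "psi M q n v $ n = - (xpart n v \<bullet> (M *\<^sub>v xpart n v)) / v $ n - xpart n v \<bullet> q"
  by (simp add: psi_def Let_def taupart_def)

lemma jac_carrier [simp]: "jac M q n v \<in> carrier_mat (n + 1) (n + 1)"
  by (rule carrier_matI) (simp_all add: jac_def Let_def)

lemma jac_dim [simp]: "dim_row (jac M q n v) = n + 1" "dim_col (jac M q n v) = n + 1"
  using jac_carrier by (blast dest: carrier_matD)+

text \<open>Moving the transposes across the scalar product leaves only the bilinear form of
  \<open>M\<close>, so the later identities become rational identities in a few scalars.\<close>

lemma jac_mult_vec:
  assumes "d \<in> carrier_vec (n + 1)"
  shows "jac M q n v *\<^sub>v d =
    (M *\<^sub>v xpart n d + d $ n \<cdot>\<^sub>v q) @\<^sub>v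
    vec 1 (\<lambda>_. - (xpart n v \<bullet> (M *\<^sub>v xpart n d) + xpart n d \<bullet> (M *\<^sub>v xpart n v)) / v $ n
      - q \<bullet> xpart n d + d $ n * (xpart n v \<bullet> (M *\<^sub>v xpart n v)) / (v $ n)\<^sup>2)"
proof -
  let ?x = "xpart n v" and ?y = "xpart n d"
  have y: "?y \<in> carrier_vec n" and x: "?x \<in> carrier_vec n" by simp_all
  have MT: "(M + M\<^sup>T)\<^sup>T = M\<^sup>T + M"
    by (simp add: transpose_add[of M n n])
  have row: "((- (1 / v $ n)) \<cdot>\<^sub>v ((M + M\<^sup>T)\<^sup>T *\<^sub>v ?x) - q) \<bullet> ?y =
     - (?x \<bullet> (M *\<^sub>v ?y) + ?y \<bullet> (M *\<^sub>v ?x)) / v $ n - q \<bullet> ?y"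
  proof -
    have a: "(M + M\<^sup>T)\<^sup>T *\<^sub>v ?x = M\<^sup>T *\<^sub>v ?x + M *\<^sub>v ?x"
      unfolding MT by (rule add_mult_distrib_mat_vec[of _ n n]) auto
    have m1: "M\<^sup>T *\<^sub>v ?x \<in> carrier_vec n" and m2: "M *\<^sub>v ?x \<in> carrier_vec n"
      by (rule mult_mat_vec_carrier[of _ n n]; simp)+
    have "(M\<^sup>T *\<^sub>v ?x + M *\<^sub>v ?x) \<bullet> ?y = ?x \<bullet> (M *\<^sub>v ?y) + ?y \<bullet> (M *\<^sub>v ?x)"
      using add_scalar_prod_distrib[OF m1 m2 y] transpose_vec_mult_scalar[OF M_carrier y x]
        comm_scalar_prod[OF m2 y] by simp
    moreover have "((- (1 / v $ n)) \<cdot>\<^sub>v (M\<^sup>T *\<^sub>v ?x + M *\<^sub>v ?x) - q) \<bullet> ?y =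
        (- (1 / v $ n)) * ((M\<^sup>T *\<^sub>v ?x + M *\<^sub>v ?x) \<bullet> ?y) - q \<bullet> ?y"
      using m1 m2 y by (subst minus_scalar_prod_distrib[of _ n]) auto
    ultimately show ?thesis
      unfolding a by (simp add: add_divide_distrib diff_divide_distrib)
  qed
  have "jac M q n v *\<^sub>v d = jac M q n v *\<^sub>v (?y @\<^sub>v vec 1 (\<lambda>_. d $ n))"
    using xpart_append_last[OF assms] by simp
  also have "\<dots> = (M *\<^sub>v ?y + mat_of_cols n [q] *\<^sub>v vec 1 (\<lambda>_. d $ n)) @\<^sub>v
     (mat_of_rows n [(- (1 / v $ n)) \<cdot>\<^sub>v ((M + M\<^sup>T)\<^sup>T *\<^sub>v ?x) - q] *\<^sub>v ?y +
      mat 1 1 (\<lambda>_. (?x \<bullet> (M *\<^sub>v ?x)) / (v $ n)\<^sup>2) *\<^sub>v vec 1 (\<lambda>_. d $ n))"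
    unfolding jac_def Let_def taupart_def
    by (rule four_block_mat_mult_vec[of _ n n _ 1 _ 1]) auto
  also have "mat_of_cols n [q] *\<^sub>v vec 1 (\<lambda>_. d $ n) = d $ n \<cdot>\<^sub>v q"
    by (intro eq_vecI) (auto simp: scalar_prod_def mat_of_cols_def)
  also have "mat_of_rows n [(- (1 / v $ n)) \<cdot>\<^sub>v ((M + M\<^sup>T)\<^sup>T *\<^sub>v ?x) - q] *\<^sub>v ?y +
      mat 1 1 (\<lambda>_. (?x \<bullet> (M *\<^sub>v ?x)) / (v $ n)\<^sup>2) *\<^sub>v vec 1 (\<lambda>_. d $ n)
     = vec 1 (\<lambda>_. - (?x \<bullet> (M *\<^sub>v ?y) + ?y \<bullet> (M *\<^sub>v ?x)) / v $ n
      - q \<bullet> ?y + d $ n * (?x \<bullet> (M *\<^sub>v ?x)) / (v $ n)\<^sup>2)"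
  proof -
    let ?w = "(- (1 / v $ n)) \<cdot>\<^sub>v ((M + M\<^sup>T)\<^sup>T *\<^sub>v ?x) - q"
    have "row (mat_of_rows n [?w]) 0 = ?w"
      by (subst mat_of_rows_row) (auto intro!: carrier_vecI)
    moreover have "(mat_of_rows n [?w] *\<^sub>v ?y) $ 0 = row (mat_of_rows n [?w]) 0 \<bullet> ?y"
      by simp
    ultimately have "(mat_of_rows n [?w] *\<^sub>v ?y) $ 0 = ?w \<bullet> ?y" by (simp only:)
    then show ?thesis
      unfolding row by (intro eq_vecI)
        (auto simp: mult_mat_vec_def[of "mat _ _ _"] scalar_prod_def[of "vec _ _"]
          simp del: index_mult_mat_vec)
  qed
  finally show ?thesis .
qed

lemma xpart_jac_mult_vec:
  assumes "d \<in> carrier_vec (n + 1)"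
  shows "xpart n (jac M q n v *\<^sub>v d) = M *\<^sub>v xpart n d + d $ n \<cdot>\<^sub>v q"
  unfolding jac_mult_vec[OF assms] by (intro eq_vecI) (auto simp: xpart_def)

lemma jac_mult_vec_index_last:
  assumes "d \<in> carrier_vec (n + 1)"
  shows "(jac M q n v *\<^sub>v d) $ n =
    - (xpart n v \<bullet> (M *\<^sub>v xpart n d) + xpart n d \<bullet> (M *\<^sub>v xpart n v)) / v $ n
      - q \<bullet> xpart n d + d $ n * (xpart n v \<bullet> (M *\<^sub>v xpart n v)) / (v $ n)\<^sup>2"
  unfolding jac_mult_vec[OF assms] by simp

lemma Mv_carrier [simp]: "M *\<^sub>v v \<in> carrier_vec n"
  by (rule carrier_vecI) simp

text \<open>The last coordinate of \<open>psi\<close>, multiplied by \<open>v $ n\<close>, is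
  exactly the negative of what the first \<open>n\<close> coordinates contribute.\<close>

lemma scalar_prod_psi_self:
  assumes "v \<in> carrier_vec (n + 1)" "v $ n \<noteq> 0"
  shows "v \<bullet> psi M q n v = 0"
  unfolding scalar_prod_split_last[OF assms(1) psi_carrier] xpart_psi psi_index_last
  using assms by (simp add: scalar_prod_add_distrib[of _ n] field_simps)

text \<open>This is the derivative of the identity \<open>scalar_prod_psi_self\<close> in direction
  \<open>d\<close>, checked here by direct computation.\<close>

lemma scalar_prod_jac_mult_vec:
  assumes "v \<in> carrier_vec (n + 1)" "d \<in> carrier_vec (n + 1)" "v $ n \<noteq> 0"
  shows "v \<bullet> (jac M q n v *\<^sub>v d) = - (psi M q n v \<bullet> d)"
proof -
  have J: "jac M q n v *\<^sub>v d \<in> carrier_vec (n + 1)" by (rule carrier_vecI) simp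
  show ?thesis
    unfolding scalar_prod_split_last[OF assms(1) J] scalar_prod_split_last[OF psi_carrier assms(2)]
      xpart_jac_mult_vec[OF assms(2)] jac_mult_vec_index_last[OF assms(2)] xpart_psi psi_index_last
    using assms comm_scalar_prod[of "xpart n v" n q] comm_scalar_prod[of "xpart n d" n "M *\<^sub>v xpart n v"]
    by (simp add: scalar_prod_add_distrib[of _ n] add_scalar_prod_distrib[of _ n]
        field_simps power2_eq_square)
qed

text \<open>This is \<open>\<tau>\<close> times the derivative of \<open>x/\<tau>\<close> in direction \<open>d\<close>.
  Being positively homogeneous, \<open>\<psi>\<close> is curved only along it, so one quadratic form governs
  both the monotonicity and the linearisation error of \<open>\<psi>\<close>.\<close>
definition projective_dir :: "real vec \<Rightarrow> real vec \<Rightarrow> real vec" where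
  "projective_dir v d = xpart n d + (- (d $ n / v $ n)) \<cdot>\<^sub>v xpart n v"

lemma projective_dir_carrier [simp]: "projective_dir v d \<in> carrier_vec n"
  by (auto simp: projective_dir_def)

lemma projective_dir_form:
  "projective_dir v d \<bullet> (M *\<^sub>v projective_dir v d) =
    xpart n d \<bullet> (M *\<^sub>v xpart n d)
    - (d $ n / v $ n) * (xpart n v \<bullet> (M *\<^sub>v xpart n d) + xpart n d \<bullet> (M *\<^sub>v xpart n v))
    + (d $ n / v $ n)\<^sup>2 * (xpart n v \<bullet> (M *\<^sub>v xpart n v))"
  unfolding projective_dir_def
  by (simp add: mult_add_distrib_mat_vec[of _ n n] mult_mat_vec[of _ n n] scalar_prod_add_distrib[of _ n]
     add_scalar_prod_distrib[of _ n] algebra_simps power2_eq_square)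

text \<open>The two occurrences of \<open>q\<close> are skew to each other and cancel. The remaining
  terms are the expansion of the quadratic form at \<open>projective_dir v d\<close>.\<close>

lemma jac_form:
  assumes "d \<in> carrier_vec (n + 1)" "v $ n \<noteq> 0"
  shows "d \<bullet> (jac M q n v *\<^sub>v d) = projective_dir v d \<bullet> (M *\<^sub>v projective_dir v d)"
proof -
  have J: "jac M q n v *\<^sub>v d \<in> carrier_vec (n + 1)" by (rule carrier_vecI) simp
  show ?thesis
    unfolding scalar_prod_split_last[OF assms(1) J]
      xpart_jac_mult_vec[OF assms(1)] jac_mult_vec_index_last[OF assms(1)] projective_dir_form
    using assms comm_scalar_prod[of "xpart n d" n q]
    by (simp add: scalar_prod_add_distrib[of _ n] field_simps power2_eq_square)
qed

text \<open>The first \<open>n\<close> coordinates are linear in \<open>v\<close>. In the last one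
  only the quotient of a quadratic form by \<open>v $ n\<close> is nonlinear, and its first-order
  Taylor remainder has a closed form with the new last coordinate as denominator.\<close>

lemma psi_add:
  assumes "v \<in> carrier_vec (n + 1)" "d \<in> carrier_vec (n + 1)" "v $ n \<noteq> 0" "v $ n + d $ n \<noteq> 0" "i < n + 1"
  shows "psi M q n (v + d) $ i = psi M q n v $ i + (jac M q n v *\<^sub>v d) $ i
    - (if i = n then (projective_dir v d \<bullet> (M *\<^sub>v projective_dir v d)) / (v $ n + d $ n) else 0)"
proof -
  have xp: "xpart n (v + d) = xpart n v + xpart n d"
    using assms by (intro eq_vecI) (auto simp: xpart_def)
  show ?thesis
  proof (cases "i = n")
    case False
    then have i: "i < n" using assms by simp
    have "(jac M q n v *\<^sub>v d) $ i = xpart n (jac M q n v *\<^sub>v d) $ i"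
      using i by (simp add: xpart_def)
    then show ?thesis
      using i assms False unfolding xpart_jac_mult_vec[OF assms(2)] 
      by (simp add: psi_index_less xp mult_add_distrib_mat_vec[of _ n n] algebra_simps)
  next
    case True
    have "q \<bullet> xpart n d = xpart n d \<bullet> q" by (rule comm_scalar_prod[of _ n]) auto
    then show ?thesis
      unfolding True psi_index_last xp jac_mult_vec_index_last[OF assms(2)] projective_dir_form
      using assms
      by (simp add: mult_add_distrib_mat_vec[of _ n n] scalar_prod_add_distrib[of _ n]
          add_scalar_prod_distrib[of _ n] power2_eq_square divide_simps) (simp add: algebra_simps)
  qed
qed

section \<open>Unique solvability of the Newton system\<close>

lemma newton_sol_iff:
  assumes v: "v \<in> carrier_vec (n + 1)" and s: "s \<in> carrier_vec (n + 1)"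
  shows "newton_sol M q n \<eta> \<gamma> v s d \<longleftrightarrow>
    fst d \<in> carrier_vec (n + 1) \<and> snd d \<in> carrier_vec (n + 1) \<and>
    (\<forall>i<n+1. snd d $ i = (jac M q n v *\<^sub>v fst d) $ i - \<eta> * (s $ i - psi M q n v $ i)) \<and>
    (\<forall>i<n+1. v $ i * snd d $ i + s $ i * fst d $ i = \<gamma> * mu_bar n v s - v $ i * s $ i)"
proof -
  have dims: "dim_vec v = n + 1" "dim_vec s = n + 1" using v s by auto
  have "snd d - jac M q n v *\<^sub>v fst d = - (\<eta> \<cdot>\<^sub>v resid M q n v s) \<longleftrightarrow>
      (\<forall>i<n+1. snd d $ i = (jac M q n v *\<^sub>v fst d) $ i - \<eta> * (s $ i - psi M q n v $ i))"
    if "snd d \<in> carrier_vec (n + 1)"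
    using that dims unfolding vec_eq_iff resid_def
    by (auto simp: algebra_simps simp del: index_mult_mat_vec)
  moreover have "hadamard v (snd d) + hadamard s (fst d)
       = (\<gamma> * mu_bar n v s) \<cdot>\<^sub>v ones (n + 1) - hadamard v s \<longleftrightarrow>
    (\<forall>i<n+1. v $ i * snd d $ i + s $ i * fst d $ i = \<gamma> * mu_bar n v s - v $ i * s $ i)"
    using dims unfolding vec_eq_iff hadamard_def ones_def by auto
  ultimately show ?thesis unfolding newton_sol_def by blast
qed

text \<open>Infinitesimal monotonicity of \<open>psi\<close>. Through it \<open>M_psd\<close> enters
  both the solvability of the Newton system and the analysis of a step.\<close>

lemma jac_form_nonneg:
  assumes "d \<in> carrier_vec (n + 1)" "v $ n \<noteq> 0"
  shows "d \<bullet> (jac M q n v *\<^sub>v d) \<ge> 0"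
  unfolding jac_form[OF assms] by (simp add: M_psd)

text \<open>Uniqueness is required because \<open>algA_step\<close> selects the direction by
  \<open>THE\<close>. Eliminating the slack direction leaves a square system with matrix diag(v) J +
  diag(s), named \<open>K\<close>. A kernel vector d has d . J d equal to minus the sum of (s_i /
  v_i) d_i^2, and \<open>jac_form_nonneg\<close> then forces d = 0.\<close>

lemma newton_sol_ex1:
  assumes v: "v \<in> carrier_vec (n + 1)" and s: "s \<in> carrier_vec (n + 1)"
    and pos: "pos_vec v" "pos_vec s"
  shows "\<exists>!d. newton_sol M q n \<eta> \<gamma> v s d"
proof -
  have dims: "dim_vec v = n + 1" "dim_vec s = n + 1" using v s by auto
  have vpos: "v $ i > 0" and spos: "s $ i > 0" if "i < n + 1" for i
    using pos that dims by (auto simp: pos_vec_def)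
  let ?J = "jac M q n v"
  define K where "K = mat (n + 1) (n + 1)
    (\<lambda>(i, j). v $ i * ?J $$ (i, j) + (if j = i then s $ i else 0))"
  have K: "K \<in> carrier_mat (n + 1) (n + 1)" by (simp add: K_def)
  have K_mult: "(K *\<^sub>v d) $ i = v $ i * (?J *\<^sub>v d) $ i + s $ i * d $ i"
    if "d \<in> carrier_vec (n + 1)" "i < n + 1" for d i
  proof -
    have "(K *\<^sub>v d) $ i = (\<Sum>j\<in>{0..<n+1}. (v $ i * ?J $$ (i, j) + (if j = i then s $ i else 0)) * d $ j)"
      using that by (auto simp: K_def scalar_prod_def intro!: sum.cong)
    also have "\<dots> = (\<Sum>j\<in>{0..<n+1}. v $ i * (?J $$ (i, j) * d $ j)
        + (if j = i then s $ i * d $ j else 0))"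
      by (intro sum.cong) (auto simp: algebra_simps)
    also have "\<dots> = v $ i * (\<Sum>j\<in>{0..<n+1}. ?J $$ (i, j) * d $ j) + s $ i * d $ i"
      using that by (simp add: sum.distrib sum_distrib_left del: sum.op_ivl_Suc)
    also have "(\<Sum>j\<in>{0..<n+1}. ?J $$ (i, j) * d $ j) = (?J *\<^sub>v d) $ i"
      using that by (auto simp: scalar_prod_def intro!: sum.cong)
    finally show ?thesis .
  qed
  have "det K \<noteq> 0"
  proof
    assume "det K = 0"
    then obtain d where d: "d \<in> carrier_vec (n + 1)" "d \<noteq> 0\<^sub>v (n + 1)" "K *\<^sub>v d = 0\<^sub>v (n + 1)"
      using det_0_iff_vec_prod_zero_field[OF K] by blast
    have "d $ i * (?J *\<^sub>v d) $ i = - (s $ i / v $ i * (d $ i)\<^sup>2)" if i: "i < n + 1" for i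
    proof -
      have "v $ i * (?J *\<^sub>v d) $ i = - s $ i * d $ i"
        using K_mult[OF d(1) i] d(3) i by simp
      then have "(?J *\<^sub>v d) $ i = - s $ i * d $ i / v $ i"
        using vpos[OF i] by (simp add: field_simps del: index_mult_mat_vec)
      then show ?thesis by (simp add: power2_eq_square del: index_mult_mat_vec)
    qed
    then have "d \<bullet> (?J *\<^sub>v d) = - (\<Sum>i<n+1. s $ i / v $ i * (d $ i)\<^sup>2)"
      unfolding sum_negf[symmetric]
      by (subst scalar_prod_sum[of _ "n + 1"]) (auto intro!: sum.cong simp del: index_mult_mat_vec)
    moreover have "d \<bullet> (?J *\<^sub>v d) \<ge> 0"
      using jac_form_nonneg d(1) vpos[of n] by auto
    ultimately have le: "(\<Sum>i<n+1. s $ i / v $ i * (d $ i)\<^sup>2) \<le> 0" by linarith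
    have nonneg: "s $ i / v $ i * (d $ i)\<^sup>2 \<ge> 0" if "i < n + 1" for i
      using vpos[OF that] spos[OF that] by simp
    have "d $ i = 0" if i: "i < n + 1" for i
    proof -
      have "s $ i / v $ i * (d $ i)\<^sup>2 \<le> (\<Sum>i<n+1. s $ i / v $ i * (d $ i)\<^sup>2)"
        using i nonneg by (intro member_le_sum) auto
      then have "s $ i / v $ i * (d $ i)\<^sup>2 = 0" using le nonneg[OF i] by linarith
      then show ?thesis using vpos[OF i] spos[OF i] by simp
    qed
    then have "d = 0\<^sub>v (n + 1)" using d(1) by (intro eq_vecI) auto
    with d(2) show False ..
  qed
  \<comment> \<open>The argument \<open>()\<close> only fills the extension slot of the ring record.
    Being a unit of the matrix ring provides a two-sided inverse.\<close>
  from det_non_zero_imp_unit[OF K this, of "()"]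
  obtain B where B: "B \<in> carrier_mat (n + 1) (n + 1)" "B * K = 1\<^sub>m (n + 1)" "K * B = 1\<^sub>m (n + 1)"
    unfolding Units_def ring_mat_def by auto
  \<comment> \<open>The right-hand side left after substituting the formula for the slack direction,
    here \<open>g\<close>, into the complementarity equation.\<close>
  define h where "h = vec (n + 1) (\<lambda>i. \<gamma> * mu_bar n v s - v $ i * s $ i
    + v $ i * (\<eta> * (s $ i - psi M q n v $ i)))"
  have h: "h \<in> carrier_vec (n + 1)" by (simp add: h_def)
  define g where "g = (\<lambda>d. vec (n + 1) (\<lambda>i. (?J *\<^sub>v d) $ i - \<eta> * (s $ i - psi M q n v $ i)))"
  have "newton_sol M q n \<eta> \<gamma> v s d \<longleftrightarrow> d = (B *\<^sub>v h, g (B *\<^sub>v h))" for d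
  proof -
    have eq: "newton_sol M q n \<eta> \<gamma> v s d \<longleftrightarrow>
        fst d \<in> carrier_vec (n + 1) \<and> snd d = g (fst d) \<and> K *\<^sub>v fst d = h"
    proof (cases "fst d \<in> carrier_vec (n + 1) \<and> snd d = g (fst d)")
      case True
      then have d: "fst d \<in> carrier_vec (n + 1)" "snd d = g (fst d)" by auto
      have "K *\<^sub>v fst d = h \<longleftrightarrow> (\<forall>i<n+1. (K *\<^sub>v fst d) $ i = h $ i)"
        using K h by (auto simp: vec_eq_iff simp del: index_mult_mat_vec)
      also have "\<dots> \<longleftrightarrow> (\<forall>i<n+1. v $ i * snd d $ i + s $ i * fst d $ i = \<gamma> * mu_bar n v s - v $ i * s $ i)"
        by (intro all_cong) (auto simp: K_mult[OF d(1)] d(2) g_def h_def algebra_simps simp del: index_mult_mat_vec)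
      finally show ?thesis
        unfolding newton_sol_iff[OF v s] using True by (auto simp: g_def simp del: index_mult_mat_vec)
    next
      case False
      then show ?thesis
        unfolding newton_sol_iff[OF v s] by (auto simp: g_def vec_eq_iff simp del: index_mult_mat_vec)
    qed
    have "fst d \<in> carrier_vec (n + 1) \<and> K *\<^sub>v fst d = h \<longleftrightarrow> fst d = B *\<^sub>v h"
    proof
      assume a: "fst d \<in> carrier_vec (n + 1) \<and> K *\<^sub>v fst d = h"
      then have "B *\<^sub>v h = (B * K) *\<^sub>v fst d" using B K by (metis assoc_mult_mat_vec)
      then show "fst d = B *\<^sub>v h" using a B by simp
    next
      assume a: "fst d = B *\<^sub>v h"
      have "K *\<^sub>v (B *\<^sub>v h) = (K * B) *\<^sub>v h" using B K h by (metis assoc_mult_mat_vec)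
      then show "fst d \<in> carrier_vec (n + 1) \<and> K *\<^sub>v fst d = h"
        using a B h by (simp add: mult_mat_vec_carrier[OF B(1) h, simplified])
    qed
    then show ?thesis unfolding eq by (cases d) auto
  qed
  then show ?thesis by auto
qed

end

section \<open>Estimates on finite sums\<close>

text \<open>The Euclidean norm is at most the 1-norm. It serves for the positive and negative parts
  of the perturbation and for the initial residual.\<close>

lemma sum_power2_le_power2_sum:
  fixes f :: "'a \<Rightarrow> real"
  assumes "finite I" "\<And>i. i \<in> I \<Longrightarrow> f i \<ge> 0"
  shows "(\<Sum>i\<in>I. (f i)\<^sup>2) \<le> (\<Sum>i\<in>I. f i)\<^sup>2"
proof -
  have "(\<Sum>i\<in>I. (f i)\<^sup>2) \<le> (\<Sum>i\<in>I. f i * (\<Sum>j\<in>I. f j))"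
    unfolding power2_eq_square using assms
    by (intro sum_mono mult_left_mono member_le_sum) auto
  then show ?thesis by (simp add: power2_eq_square sum_distrib_right)
qed

text \<open>When the total is zero, the negative part has the same mass as the positive part, so a
  one-sided bound controls both, and each contributes at most \<open>G\<close> squared.\<close>

lemma sum_power2_le_of_sum_zero:
  fixes f :: "'a \<Rightarrow> real"
  assumes "finite I" "(\<Sum>i\<in>I. f i) = 0" "(\<Sum>i\<in>I. max 0 (f i)) \<le> G"
  shows "(\<Sum>i\<in>I. (f i)\<^sup>2) \<le> 2 * G\<^sup>2"
proof -
  have "(\<Sum>i\<in>I. f i) = (\<Sum>i\<in>I. max 0 (f i)) - (\<Sum>i\<in>I. max 0 (- f i))"
    unfolding sum_subtractf[symmetric] by (intro sum.cong) auto
  then have neg: "(\<Sum>i\<in>I. max 0 (- f i)) \<le> G" using assms by simp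
  have "(\<Sum>i\<in>I. (f i)\<^sup>2) = (\<Sum>i\<in>I. (max 0 (f i))\<^sup>2) + (\<Sum>i\<in>I. (max 0 (- f i))\<^sup>2)"
    unfolding sum.distrib[symmetric] by (intro sum.cong) (auto simp: max_def)
  also have "\<dots> \<le> (\<Sum>i\<in>I. max 0 (f i))\<^sup>2 + (\<Sum>i\<in>I. max 0 (- f i))\<^sup>2"
    using assms(1) by (intro add_mono sum_power2_le_power2_sum) auto
  also have "\<dots> \<le> G\<^sup>2 + G\<^sup>2"
    using assms(3) neg by (intro add_mono power_mono sum_nonneg) auto
  finally show ?thesis by simp
qed

text \<open>Both bounds come from dividing the squared equation \<open>h\<close> by x_i s_i. The
  first is 4ab \<le> (a + b)^2 in each coordinate; the second expands the square and discards
  nonnegative terms.\<close>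

lemma newton_direction_bounds:
  fixes x s dx ds h :: "'a \<Rightarrow> real"
  assumes "finite I" and pos: "\<And>i. i \<in> I \<Longrightarrow> x i > 0" "\<And>i. i \<in> I \<Longrightarrow> s i > 0"
    and h: "\<And>i. i \<in> I \<Longrightarrow> x i * ds i + s i * dx i = h i"
    and nonneg: "(\<Sum>i\<in>I. dx i * ds i) \<ge> 0"
  shows "(\<Sum>i\<in>I. max 0 (dx i * ds i)) \<le> (\<Sum>i\<in>I. (h i)\<^sup>2 / (x i * s i)) / 4" (is ?A)
    and "i \<in> I \<Longrightarrow> (dx i / x i)\<^sup>2 * (x i * s i) \<le> (\<Sum>i\<in>I. (h i)\<^sup>2 / (x i * s i))"
proof -
  have "max 0 (dx i * ds i) \<le> (h i)\<^sup>2 / (x i * s i) / 4" if i: "i \<in> I" for i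
  proof -
    have "4 * (dx i * ds i) * (x i * s i) \<le> (h i)\<^sup>2"
      using zero_le_power2[of "x i * ds i - s i * dx i"]
      unfolding h[OF i, symmetric] by (simp add: power2_eq_square algebra_simps)
    then show ?thesis using pos[OF i] by (simp add: field_simps)
  qed
  then show ?A unfolding sum_divide_distrib by (rule sum_mono)
next
  assume i: "i \<in> I"
  have split: "(h i)\<^sup>2 / (x i * s i) = (dx i / x i)\<^sup>2 * (x i * s i) + (ds i / s i)\<^sup>2 * (x i * s i)
      + 2 * (dx i * ds i)" if i: "i \<in> I" for i
    unfolding h[OF i, symmetric] using pos[OF i]
    by (simp add: field_simps power2_eq_square)
  have "(dx i / x i)\<^sup>2 * (x i * s i) \<le> (\<Sum>i\<in>I. (dx i / x i)\<^sup>2 * (x i * s i))"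
    using i assms(1) pos by (intro member_le_sum) (auto simp: less_imp_le)
  \<comment> \<open>Single cross terms \<open>dx i * ds i\<close> may be negative. Only their sum
    has a sign, so they can be discarded only after summation.\<close>
  also have "\<dots> \<le> (\<Sum>i\<in>I. (dx i / x i)\<^sup>2 * (x i * s i)) + (\<Sum>i\<in>I. (ds i / s i)\<^sup>2 * (x i * s i))
      + 2 * (\<Sum>i\<in>I. dx i * ds i)"
  proof -
    have "(\<Sum>i\<in>I. (ds i / s i)\<^sup>2 * (x i * s i)) \<ge> 0"
      using pos by (intro sum_nonneg) (auto simp: less_imp_le)
    then show ?thesis using nonneg by linarith
  qed
  also have "\<dots> = (\<Sum>i\<in>I. (h i)\<^sup>2 / (x i * s i))"
    by (simp add: sum_distrib_left flip: sum.distrib) (intro sum.cong; simp add: split)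
  finally show "(dx i / x i)\<^sup>2 * (x i * s i) \<le> (\<Sum>i\<in>I. (h i)\<^sup>2 / (x i * s i))" .
qed

text \<open>Each numerator is the square of (p_i - \<mu>) + \<eta>\<mu>. The mean of
  \<open>p\<close> is \<mu>, so the mixed terms cancel in the sum, and the two squares contribute at
  most \<beta>^2 \<mu>^2 each. The neighbourhood bounds every denominator below by (1 -
  \<beta>)\<mu>.\<close>

lemma centering_residual_bound:
  fixes p :: "'a \<Rightarrow> real"
  assumes "finite I" and sum_p: "(\<Sum>i\<in>I. p i) = real (card I) * \<mu>"
    and nbhd: "(\<Sum>i\<in>I. (p i - \<mu>)\<^sup>2) \<le> (\<beta> * \<mu>)\<^sup>2"
    and \<mu>: "\<mu> > 0" and \<beta>: "0 < \<beta>" "\<beta> < 1" and \<eta>: "\<eta>\<^sup>2 * real (card I) = \<beta>\<^sup>2"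
  shows "i \<in> I \<Longrightarrow> p i \<ge> (1 - \<beta>) * \<mu>"
    and "(\<Sum>i\<in>I. ((1 - \<eta>) * \<mu> - p i)\<^sup>2 / p i) \<le> 2 * \<beta>\<^sup>2 / (1 - \<beta>) * \<mu>" (is ?B)
proof -
  have lower: "p i \<ge> (1 - \<beta>) * \<mu>" if i: "i \<in> I" for i
  proof -
    have "(p i - \<mu>)\<^sup>2 \<le> (\<Sum>i\<in>I. (p i - \<mu>)\<^sup>2)"
      using i assms(1) by (intro member_le_sum) auto
    then have "(p i - \<mu>)\<^sup>2 \<le> (\<beta> * \<mu>)\<^sup>2" using nbhd by linarith
    then have "\<bar>p i - \<mu>\<bar> \<le> \<beta> * \<mu>" using \<mu> \<beta> by (intro power2_le_imp_le[of "\<bar>p i - \<mu>\<bar>"]) auto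
    then show ?thesis by (simp add: algebra_simps)
  qed
  then show "i \<in> I \<Longrightarrow> p i \<ge> (1 - \<beta>) * \<mu>" .
  have pos: "(1 - \<beta>) * \<mu> > 0" using \<mu> \<beta> by simp
  have "(\<Sum>i\<in>I. ((1 - \<eta>) * \<mu> - p i)\<^sup>2) =
      (\<Sum>i\<in>I. (p i - \<mu>)\<^sup>2 + 2 * \<eta> * \<mu> * p i + (\<eta>\<^sup>2 * \<mu>\<^sup>2 - 2 * \<eta> * \<mu>\<^sup>2))"
    by (intro sum.cong) (auto simp: power2_eq_square algebra_simps)
  also have "\<dots> = (\<Sum>i\<in>I. (p i - \<mu>)\<^sup>2) + 2 * \<eta> * \<mu> * (\<Sum>i\<in>I. p i)
      + real (card I) * (\<eta>\<^sup>2 * \<mu>\<^sup>2 - 2 * \<eta> * \<mu>\<^sup>2)"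
    by (simp add: sum.distrib sum_distrib_left)
  also have "\<dots> = (\<Sum>i\<in>I. (p i - \<mu>)\<^sup>2) + (\<eta>\<^sup>2 * real (card I)) * \<mu>\<^sup>2"
    unfolding sum_p by (simp add: power2_eq_square algebra_simps)
  also have "\<dots> \<le> 2 * \<beta>\<^sup>2 * \<mu>\<^sup>2"
    using nbhd unfolding \<eta> by (simp add: power_mult_distrib)
  finally have total: "(\<Sum>i\<in>I. ((1 - \<eta>) * \<mu> - p i)\<^sup>2) \<le> 2 * \<beta>\<^sup>2 * \<mu>\<^sup>2" .
  have "(\<Sum>i\<in>I. ((1 - \<eta>) * \<mu> - p i)\<^sup>2 / p i) \<le> (\<Sum>i\<in>I. ((1 - \<eta>) * \<mu> - p i)\<^sup>2 / ((1 - \<beta>) * \<mu>))"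
    using less_le_trans[OF pos lower] lower pos \<mu> \<beta>
    by (intro sum_mono divide_left_mono mult_pos_pos) auto
  also have "\<dots> \<le> 2 * \<beta>\<^sup>2 * \<mu>\<^sup>2 / ((1 - \<beta>) * \<mu>)"
    unfolding sum_divide_distrib[symmetric] using total pos by (intro divide_right_mono) auto
  also have "\<dots> = 2 * \<beta>\<^sup>2 / (1 - \<beta>) * \<mu>"
    using \<mu> \<beta> by (simp add: field_simps power2_eq_square)
  finally show ?B .
qed


section \<open>Analysis of one Newton step\<close>

context monotone_lcp
begin

text \<open>The conclusions reproduce the hypotheses on \<open>v\<close> and \<open>s\<close>, so
  the step can be iterated. The third condition on \<beta> gives both positivity of
  \<open>v'\<close> and a contraction of the centrality error to at most \<beta>\<mu>/2; \<gamma>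
  \<ge> 1/2 then fits that error into the neighbourhood of the reduced target \<gamma>\<mu>.\<close>

lemma newton_step:
  fixes \<beta> \<eta> \<gamma> :: real
  assumes v: "v \<in> carrier_vec (n + 1)" and s: "s \<in> carrier_vec (n + 1)"
    and pos: "pos_vec v" "pos_vec s"
    and nbhd: "vnorm (hadamard v s - mu_bar n v s \<cdot>\<^sub>v ones (n + 1)) \<le> \<beta> * mu_bar n v s"
    and newton: "newton_sol M q n \<eta> \<gamma> v s d"
    and \<beta>: "0 < \<beta>" "\<beta> < 1" "2 * \<beta>\<^sup>2 < (1 - \<beta>)\<^sup>2"
    and \<eta>: "\<eta>\<^sup>2 * (real n + 1) = \<beta>\<^sup>2" and \<gamma>: "\<gamma> = 1 - \<eta>" "\<gamma> \<ge> 1 / 2"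
  defines "v' \<equiv> v + fst d"
  defines "s' \<equiv> psi M q n v' + \<gamma> \<cdot>\<^sub>v resid M q n v s"
  shows "v' \<in> carrier_vec (n + 1)" "s' \<in> carrier_vec (n + 1)" "pos_vec v'" "pos_vec s'"
    and "vnorm (hadamard v' s' - mu_bar n v' s' \<cdot>\<^sub>v ones (n + 1)) \<le> \<beta> * mu_bar n v' s'"
    and "resid M q n v' s' = \<gamma> \<cdot>\<^sub>v resid M q n v s"
    and "v' \<bullet> s' = \<gamma> * (v \<bullet> s)"
proof -
  define dx ds \<mu> J r where "dx = fst d" and "ds = snd d" and "\<mu> = mu_bar n v s"
    and "J = jac M q n v *\<^sub>v dx" and "r = resid M q n v s"
  have dims: "dim_vec v = n + 1" "dim_vec s = n + 1" using v s by auto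
  have vpos: "v $ i > 0" and spos: "s $ i > 0" if "i < n + 1" for i
    using pos that dims by (auto simp: pos_vec_def)
  have vn: "v $ n \<noteq> 0" using vpos[of n] by simp
  have dx: "dx \<in> carrier_vec (n + 1)" and ds: "ds \<in> carrier_vec (n + 1)"
    and ds_eq: "\<And>i. i < n + 1 \<Longrightarrow> ds $ i = J $ i - \<eta> * (s $ i - psi M q n v $ i)"
    and compl: "\<And>i. i < n + 1 \<Longrightarrow> v $ i * ds $ i + s $ i * dx $ i = \<gamma> * \<mu> - v $ i * s $ i"
    using newton unfolding newton_sol_iff[OF v s] dx_def ds_def \<mu>_def J_def by blast+
  have dims': "dim_vec dx = n + 1" "dim_vec ds = n + 1" "dim_vec J = n + 1" "dim_vec r = n + 1"
    using dx ds by (auto simp: J_def r_def resid_def)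
  have r_eq: "r $ i = s $ i - psi M q n v $ i" if "i < n + 1" for i
    using that dims by (simp add: r_def resid_def)
  have vs_sum: "(\<Sum>i<n+1. v $ i * s $ i) = (real n + 1) * \<mu>"
    using scalar_prod_sum[OF dims(2), of v] by (simp add: \<mu>_def mu_bar_def)
  have "0 < (\<Sum>i<n+1. v $ i * s $ i)" using vpos spos by (intro sum_pos) auto
  then have \<mu>: "\<mu> > 0" unfolding vs_sum by (simp add: zero_less_mult_iff)
  have psi_v: "(\<Sum>i<n+1. v $ i * psi M q n v $ i) = 0"
    using scalar_prod_psi_self[OF v vn] scalar_prod_sum[OF psi_dim, of v v] by simp
  have J_v: "(\<Sum>i<n+1. v $ i * J $ i) = - (\<Sum>i<n+1. psi M q n v $ i * dx $ i)"
    using scalar_prod_jac_mult_vec[OF v dx vn] scalar_prod_sum[OF dims'(3), of v]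
      scalar_prod_sum[OF dims'(1), of "psi M q n v"] by (simp add: J_def)
  \<comment> \<open>The complementarity equations are summed in two ways. On the right, \<gamma> = 1
    - \<eta> leaves -\<eta> (v . s). On the left, \<open>J_v\<close> and \<open>psi_v\<close> remove
    everything except this same term and dx . r.\<close>
  have ortho: "(\<Sum>i<n+1. dx $ i * r $ i) = 0"
  proof -
    have "(\<Sum>i<n+1. v $ i * ds $ i + s $ i * dx $ i) = (\<Sum>i<n+1. \<gamma> * \<mu> - v $ i * s $ i)"
      using compl by (intro sum.cong) auto
    also have "\<dots> = - \<eta> * (\<Sum>i<n+1. v $ i * s $ i)"
      unfolding sum_subtractf vs_sum by (simp add: \<gamma> algebra_simps)
    finally have "(\<Sum>i<n+1. v $ i * ds $ i + s $ i * dx $ i) = - \<eta> * (\<Sum>i<n+1. v $ i * s $ i)" .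
    moreover have "(\<Sum>i<n+1. v $ i * ds $ i + s $ i * dx $ i) =
        (\<Sum>i<n+1. v $ i * J $ i + psi M q n v $ i * dx $ i - \<eta> * (v $ i * s $ i)
          + \<eta> * (v $ i * psi M q n v $ i) + dx $ i * r $ i)"
      by (intro sum.cong) (auto simp: ds_eq r_eq algebra_simps)
    moreover have "\<dots> = - \<eta> * (\<Sum>i<n+1. v $ i * s $ i) + (\<Sum>i<n+1. dx $ i * r $ i)"
      using J_v psi_v by (simp add: sum.distrib sum_subtractf flip: sum_distrib_left)
    ultimately show ?thesis by linarith
  qed
  define W where "W = (\<Sum>i<n+1. dx $ i * ds $ i)"
  have "W = (\<Sum>i<n+1. dx $ i * J $ i - \<eta> * (dx $ i * r $ i))"
    unfolding W_def by (intro sum.cong) (auto simp: ds_eq r_eq algebra_simps)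
  also have "\<dots> = dx \<bullet> J"
    unfolding sum_subtractf sum_distrib_left[symmetric] ortho scalar_prod_sum[OF dims'(3)] by simp
  finally have W: "W = dx \<bullet> J" .
  have W_nonneg: "W \<ge> 0" unfolding W J_def by (rule jac_form_nonneg[OF dx vn])

  define H where "H = (\<Sum>i<n+1. (\<gamma> * \<mu> - v $ i * s $ i)\<^sup>2 / (v $ i * s $ i))"
  have "vnorm (hadamard v s - \<mu> \<cdot>\<^sub>v ones (n + 1)) = sqrt (\<Sum>i<n+1. (v $ i * s $ i - \<mu>)\<^sup>2)"
    unfolding vnorm_def using dims
    by (subst scalar_prod_sum[of _ "n + 1"])
      (auto simp: hadamard_def ones_def power2_eq_square intro!: sum.cong arg_cong[of _ _ sqrt])
  then have "sqrt (\<Sum>i<n+1. (v $ i * s $ i - \<mu>)\<^sup>2) \<le> \<beta> * \<mu>"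
    using nbhd by (simp add: \<mu>_def)
  then have nbhd': "(\<Sum>i<n+1. (v $ i * s $ i - \<mu>)\<^sup>2) \<le> (\<beta> * \<mu>)\<^sup>2"
    by (rule sqrt_le_D)
  note bound = centering_residual_bound[of "{..<n+1}" "\<lambda>i. v $ i * s $ i" \<mu> \<beta> \<eta>,
      OF _ _ nbhd' \<mu> \<beta>(1,2)]
  have lower: "v $ i * s $ i \<ge> (1 - \<beta>) * \<mu>" if "i < n + 1" for i
    by (rule bound(1)) (use that vs_sum \<eta> in \<open>auto simp: add.commute\<close>)
  have H: "H \<le> 2 * \<beta>\<^sup>2 / (1 - \<beta>) * \<mu>"
    unfolding H_def \<gamma>(1) by (rule bound(2)) (use vs_sum \<eta> in \<open>auto simp: add.commute\<close>)
  note dir = newton_direction_bounds[of "{..<n+1}" "\<lambda>i. v $ i" "\<lambda>i. s $ i" "\<lambda>i. ds $ i" "\<lambda>i. dx $ i"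
      "\<lambda>i. \<gamma> * \<mu> - v $ i * s $ i", folded H_def W_def]
  have dir1: "(\<Sum>i<n+1. max 0 (dx $ i * ds $ i)) \<le> H / 4"
    by (rule dir(1)) (use vpos spos compl W_nonneg in auto)
  have dir2: "(dx $ i / v $ i)\<^sup>2 * (v $ i * s $ i) \<le> H" if "i < n + 1" for i
    by (rule dir(2)) (use vpos spos compl W_nonneg that in auto)

  have v'_eq: "v' $ i = v $ i + dx $ i" if "i < n + 1" for i
    using that dims dims' by (simp add: v'_def dx_def)
  have v'pos: "v' $ i > 0" if i: "i < n + 1" for i
  proof -
    have "(dx $ i / v $ i)\<^sup>2 * ((1 - \<beta>) * \<mu>) \<le> 2 * \<beta>\<^sup>2 / (1 - \<beta>) * \<mu>"
      using mult_left_mono[OF lower[OF i] zero_le_power2[of "dx $ i / v $ i"]] dir2[OF i] H by linarith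
    then have "((dx $ i / v $ i)\<^sup>2 * (1 - \<beta>)\<^sup>2) * \<mu> \<le> (2 * \<beta>\<^sup>2) * \<mu>"
      using \<beta>(2) by (simp add: pos_le_divide_eq power2_eq_square mult_ac)
    then have "(dx $ i / v $ i)\<^sup>2 * (1 - \<beta>)\<^sup>2 \<le> 2 * \<beta>\<^sup>2"
      using \<mu> by simp
    also have "\<dots> < 1 * (1 - \<beta>)\<^sup>2" using \<beta>(3) by simp
    finally have "(dx $ i / v $ i)\<^sup>2 < 1" using \<beta>(2) by (simp only: mult_less_cancel_right_pos zero_less_power2)
    then have "\<bar>dx $ i / v $ i\<bar> < 1" by (simp add: abs_square_less_1)
    then have "- 1 < dx $ i / v $ i" by linarith
    then show ?thesis using vpos[OF i] v'_eq[OF i] by (simp add: field_simps)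
  qed
  show v': "v' \<in> carrier_vec (n + 1)" using v dx by (simp add: v'_def dx_def)
  show s': "s' \<in> carrier_vec (n + 1)" using dims' by (intro carrier_vecI) (simp add: s'_def r_def)
  have dims'': "dim_vec v' = n + 1" "dim_vec s' = n + 1" using v' s' by auto
  show "pos_vec v'" using v'pos dims'' by (simp add: pos_vec_def)
  \<comment> \<open>With psi(v) = s - r, J = ds + \<eta> r and \<gamma> = 1 - \<eta>, the residual
    cancels from psi(v) + J + \<gamma> r. Hence \<open>s'\<close> differs from the plain update s +
    ds only by the curvature of \<open>psi\<close>.\<close>
  have s'_eq: "s' $ i = s $ i + ds $ i - (if i = n then W / v' $ n else 0)" if i: "i < n + 1" for i
  proof -
    have "s' $ i = psi M q n v' $ i + \<gamma> * r $ i"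
      using i dims' by (simp add: s'_def flip: r_def)
    also have "psi M q n v' $ i = psi M q n v $ i + J $ i - (if i = n then W / v' $ n else 0)"
      using psi_add[OF v dx vn _ i] v'pos[of n] v'_eq[of n] jac_form[OF dx vn]
      unfolding W J_def by (simp add: v'_def dx_def del: index_mult_mat_vec)
    finally show ?thesis
      using ds_eq[OF i] r_eq[OF i] by (simp add: \<gamma> algebra_simps)
  qed
  \<comment> \<open>Multiplication by \<open>v' $ n\<close> clears the denominator of the curvature
    term, so the last product is corrected by exactly \<open>W\<close>. As \<open>W\<close> is the
    sum of all \<open>dx $ i * ds $ i\<close>, the perturbation has total zero and the new mean is
    exactly \<gamma>\<mu>.\<close>
  define f where "f = (\<lambda>i. dx $ i * ds $ i - (if i = n then W else 0))"
  have prod_eq: "v' $ i * s' $ i = \<gamma> * \<mu> + f i" if i: "i < n + 1" for i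
  proof -
    have "v' $ i * s' $ i = v' $ i * (s $ i + ds $ i) - (if i = n then W else 0)"
      using v'pos[of n] unfolding s'_eq[OF i] by (simp add: right_diff_distrib)
    also have "v' $ i * (s $ i + ds $ i) = \<gamma> * \<mu> + dx $ i * ds $ i"
      using compl[OF i] unfolding v'_eq[OF i] by (simp add: algebra_simps)
    finally show ?thesis by (simp add: f_def)
  qed
  have f_sum: "(\<Sum>i<n+1. f i) = 0"
    unfolding f_def sum_subtractf W_def[symmetric] by simp
  \<comment> \<open>Subtracting the nonnegative \<open>W\<close> from the last entry can only shrink
    its positive part.\<close>
  have "(\<Sum>i<n+1. max 0 (f i)) \<le> (\<Sum>i<n+1. max 0 (dx $ i * ds $ i))"
    using W_nonneg by (intro sum_mono) (auto simp: f_def)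
  also have "\<dots> \<le> (2 * \<beta>\<^sup>2 / (1 - \<beta>) * \<mu>) / 4"
    using dir1 H by (meson divide_right_mono order_trans zero_le_numeral)
  finally have "(\<Sum>i<n+1. (f i)\<^sup>2) \<le> 2 * ((2 * \<beta>\<^sup>2 / (1 - \<beta>) * \<mu>) / 4)\<^sup>2"
    using f_sum by (intro sum_power2_le_of_sum_zero) auto
  also have "\<dots> = (\<beta> * \<mu>)\<^sup>2 * ((2 * \<beta>\<^sup>2) / (1 - \<beta>)\<^sup>2) / 4"
  proof -
    have "2 * ((2 * \<beta>\<^sup>2 / t * \<mu>) / 4)\<^sup>2 = (\<beta> * \<mu>)\<^sup>2 * ((2 * \<beta>\<^sup>2) / t\<^sup>2) / 4" for t :: real
      by (simp add: power2_eq_square)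
    then show ?thesis .
  qed
  \<comment> \<open>The factor 2\<beta>^2 / (1 - \<beta>)^2 is below 1 by the third condition on
    \<beta>.\<close>
  also have "\<dots> \<le> (\<beta> * \<mu>)\<^sup>2 * 1 / 4"
    using \<beta> by (intro divide_right_mono mult_left_mono) auto
  also have "\<dots> = (\<beta> * ((1 / 2) * \<mu>))\<^sup>2" by (simp add: power2_eq_square)
  also have "\<dots> \<le> (\<beta> * (\<gamma> * \<mu>))\<^sup>2"
    using \<beta> \<gamma> \<mu> by (intro power_mono mult_left_mono mult_right_mono) auto
  finally have f_bound: "(\<Sum>i<n+1. (f i)\<^sup>2) \<le> (\<beta> * (\<gamma> * \<mu>))\<^sup>2" .
  have \<gamma>\<mu>: "\<gamma> * \<mu> > 0" using \<gamma> \<mu> by simp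
  \<comment> \<open>Each product lies within \<beta>\<gamma>\<mu> < \<gamma>\<mu> of \<gamma>\<mu>
    and is therefore positive; the sign of \<open>s'\<close> follows from that of
    \<open>v'\<close>.\<close>
  have s'pos: "s' $ i > 0" if i: "i < n + 1" for i
  proof -
    have "(f i)\<^sup>2 \<le> (\<Sum>i<n+1. (f i)\<^sup>2)" using i by (intro member_le_sum) auto
    then have "\<bar>f i\<bar> \<le> \<beta> * (\<gamma> * \<mu>)"
      using f_bound \<beta> \<gamma>\<mu> by (intro power2_le_imp_le[of "\<bar>f i\<bar>"]) auto
    also have "\<dots> < \<gamma> * \<mu>" using mult_strict_right_mono[OF \<beta>(2) \<gamma>\<mu>] by simp
    finally have "v' $ i * s' $ i > 0" unfolding prod_eq[OF i] by linarith
    then show ?thesis using v'pos[OF i] by (simp add: zero_less_mult_iff)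
  qed
  then show "pos_vec s'" using dims'' by (simp add: pos_vec_def)
  have "v' \<bullet> s' = (\<Sum>i<n+1. \<gamma> * \<mu> + f i)"
    unfolding scalar_prod_sum[OF dims''(2)] using prod_eq by (intro sum.cong) auto
  also have "\<dots> = (real n + 1) * (\<gamma> * \<mu>)"
    unfolding sum.distrib f_sum by (simp add: algebra_simps)
  finally have inner: "v' \<bullet> s' = (real n + 1) * (\<gamma> * \<mu>)" .
  have "v \<bullet> s = (real n + 1) * \<mu>" by (simp add: \<mu>_def mu_bar_def)
  then show "v' \<bullet> s' = \<gamma> * (v \<bullet> s)" unfolding inner by simp
  have mu': "mu_bar n v' s' = \<gamma> * \<mu>" unfolding mu_bar_def inner by simp
  have "vnorm (hadamard v' s' - (\<gamma> * \<mu>) \<cdot>\<^sub>v ones (n + 1)) = sqrt (\<Sum>i<n+1. (f i)\<^sup>2)"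
    unfolding vnorm_def using dims''
    by (subst scalar_prod_sum[of _ "n + 1"])
      (auto simp: hadamard_def ones_def power2_eq_square prod_eq intro!: sum.cong arg_cong[of _ _ sqrt])
  also have "\<dots> \<le> \<beta> * (\<gamma> * \<mu>)"
    using f_bound \<beta> \<gamma>\<mu> by (intro real_le_lsqrt) auto
  finally show "vnorm (hadamard v' s' - mu_bar n v' s' \<cdot>\<^sub>v ones (n + 1)) \<le> \<beta> * mu_bar n v' s'"
    unfolding mu' .
  show "resid M q n v' s' = \<gamma> \<cdot>\<^sub>v resid M q n v s"
    using dims' unfolding r_def[symmetric]
    by (intro eq_vecI) (auto simp: resid_def s'_def r_eq)
qed

end

section \<open>Monotonicity of the quadratic-programming data\<close>

text \<open>The blocks A and -A^T contribute opposite scalars, so the form of \<open>lcp_M\<close>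
  at (y, z) reduces to y . Q y, and a nonnegative factor \<open>a\<close> preserves its
  sign.\<close>

lemma monotone_lcp_scaled_lcp_M:
  assumes Q: "Q \<in> carrier_mat nz nz" and psd: "\<forall>v \<in> carrier_vec nz. v \<bullet> (Q *\<^sub>v v) \<ge> 0"
    and A: "A \<in> carrier_mat nb nz" and c: "c \<in> carrier_vec nz" and b: "b \<in> carrier_vec nb"
    and a: "a \<ge> 0"
  shows "monotone_lcp (a \<cdot>\<^sub>m lcp_M Q A nb) (a \<cdot>\<^sub>v lcp_q c b) (nz + nb)"
proof
  have M: "lcp_M Q A nb \<in> carrier_mat (nz + nb) (nz + nb)"
    unfolding lcp_M_def by (rule four_block_carrier_mat) (use Q in auto)
  then show "a \<cdot>\<^sub>m lcp_M Q A nb \<in> carrier_mat (nz + nb) (nz + nb)" by simp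
  show "a \<cdot>\<^sub>v lcp_q c b \<in> carrier_vec (nz + nb)"
    using b c by (auto simp: lcp_q_def)
  fix v :: "real vec" assume v: "v \<in> carrier_vec (nz + nb)"
  define y z where "y = vec_first v nz" and "z = vec_last v nb"
  have y: "y \<in> carrier_vec nz" and z: "z \<in> carrier_vec nb" by (auto simp: y_def z_def)
  have vyz: "v = y @\<^sub>v z" using vec_first_last_append[OF v] by (simp add: y_def z_def)
  have A_T: "A\<^sup>T *\<^sub>v z \<in> carrier_vec nz" and Qy: "Q *\<^sub>v y \<in> carrier_vec nz"
    and Ay: "A *\<^sub>v y \<in> carrier_vec nb"
    using A Q y z by (auto intro: mult_mat_vec_carrier)
  have "lcp_M Q A nb *\<^sub>v v = (Q *\<^sub>v y + - (A\<^sup>T) *\<^sub>v z) @\<^sub>v (A *\<^sub>v y + 0\<^sub>m nb nb *\<^sub>v z)"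
    unfolding lcp_M_def vyz by (rule four_block_mat_mult_vec) (use Q A y z in auto)
  also have "- (A\<^sup>T) *\<^sub>v z = - (A\<^sup>T *\<^sub>v z)"
    using A z by (intro uminus_mult_mat_vec) auto
  also have "0\<^sub>m nb nb *\<^sub>v z = 0\<^sub>v nb" using z by (intro eq_vecI) auto
  finally have Mv: "lcp_M Q A nb *\<^sub>v v = (Q *\<^sub>v y + - (A\<^sup>T *\<^sub>v z)) @\<^sub>v (A *\<^sub>v y)"
    using Ay by simp
  have "v \<bullet> (lcp_M Q A nb *\<^sub>v v) = y \<bullet> (Q *\<^sub>v y + - (A\<^sup>T *\<^sub>v z)) + z \<bullet> (A *\<^sub>v y)"
    unfolding Mv unfolding vyz by (rule scalar_prod_append) (use y z Qy A_T Ay in auto)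
  also have "y \<bullet> (Q *\<^sub>v y + - (A\<^sup>T *\<^sub>v z)) = y \<bullet> (Q *\<^sub>v y) + y \<bullet> (- (A\<^sup>T *\<^sub>v z))"
    by (rule scalar_prod_add_distrib) (use y Qy A_T in auto)
  also have "y \<bullet> (- (A\<^sup>T *\<^sub>v z)) = - (y \<bullet> (A\<^sup>T *\<^sub>v z))"
    using y A_T by (intro scalar_prod_uminus_right) (simp only: carrier_vecD)
  also have "y \<bullet> (A\<^sup>T *\<^sub>v z) = z \<bullet> (A *\<^sub>v y)"
    using comm_scalar_prod[OF y A_T] transpose_vec_mult_scalar[OF A y z] by simp
  finally have "v \<bullet> (lcp_M Q A nb *\<^sub>v v) = y \<bullet> (Q *\<^sub>v y)" by simp
  moreover have "(a \<cdot>\<^sub>m lcp_M Q A nb) *\<^sub>v v = a \<cdot>\<^sub>v (lcp_M Q A nb *\<^sub>v v)"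
    using smult_mat_mult_vec[OF M v] .
  ultimately show "v \<bullet> ((a \<cdot>\<^sub>m lcp_M Q A nb) *\<^sub>v v) \<ge> 0"
    using psd y a M v by simp
qed


section \<open>Invariant of the iteration and size of the initial residual\<close>

context monotone_lcp
begin

text \<open>The invariant sustains itself, so it holds for every \<open>k\<close>. At the start all
  products equal 1, and the centrality error is zero.\<close>

lemma algA_iter_invariant:
  fixes \<beta> \<eta> \<gamma> :: real and k :: nat
  assumes \<beta>: "0 < \<beta>" "\<beta> < 1" "2 * \<beta>\<^sup>2 < (1 - \<beta>)\<^sup>2"
    and \<eta>: "\<eta>\<^sup>2 * (real n + 1) = \<beta>\<^sup>2" and \<gamma>: "\<gamma> = 1 - \<eta>" "\<gamma> \<ge> 1 / 2"
  defines "v \<equiv> \<lambda>k. fst (algA_iter M q n \<eta> \<gamma> k)" and "s \<equiv> \<lambda>k. snd (algA_iter M q n \<eta> \<gamma> k)"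
  shows "v k \<in> carrier_vec (n + 1) \<and> s k \<in> carrier_vec (n + 1) \<and> pos_vec (v k) \<and> pos_vec (s k) \<and>
    vnorm (hadamard (v k) (s k) - mu_bar n (v k) (s k) \<cdot>\<^sub>v ones (n + 1)) \<le> \<beta> * mu_bar n (v k) (s k) \<and>
    resid M q n (v k) (s k) = \<gamma> ^ k \<cdot>\<^sub>v resid M q n (v 0) (s 0) \<and>
    v k \<bullet> s k = \<gamma> ^ k * (real n + 1)"
proof (induction k)
  case 0
  have inner: "v 0 \<bullet> s 0 = real n + 1"
    by (simp add: v_def s_def ones_def scalar_prod_def)
  then have "mu_bar n (v 0) (s 0) = 1" by (simp add: mu_bar_def)
  moreover have "hadamard (v 0) (s 0) - 1 \<cdot>\<^sub>v ones (n + 1) = 0\<^sub>v (n + 1)"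
    by (intro eq_vecI) (auto simp: v_def s_def hadamard_def ones_def)
  ultimately show ?case
    using \<beta> inner by (auto simp: v_def s_def ones_def pos_vec_def vnorm_def scalar_prod_def)
next
  case (Suc k)
  let ?d = "THE d. newton_sol M q n \<eta> \<gamma> (v k) (s k) d"
  have IH: "v k \<in> carrier_vec (n + 1)" "s k \<in> carrier_vec (n + 1)" "pos_vec (v k)" "pos_vec (s k)"
    "vnorm (hadamard (v k) (s k) - mu_bar n (v k) (s k) \<cdot>\<^sub>v ones (n + 1)) \<le> \<beta> * mu_bar n (v k) (s k)"
    "resid M q n (v k) (s k) = \<gamma> ^ k \<cdot>\<^sub>v resid M q n (v 0) (s 0)"
    "v k \<bullet> s k = \<gamma> ^ k * (real n + 1)"
    using Suc.IH by blast+
  \<comment> \<open>The induction hypothesis supplies positivity, hence unique solvability, so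
    \<open>THE\<close> denotes a genuine solution.\<close>
  have sol: "newton_sol M q n \<eta> \<gamma> (v k) (s k) ?d"
    by (rule theI'[OF newton_sol_ex1[OF IH(1-4)]])
  have eqs: "v (Suc k) = v k + fst ?d"
    "s (Suc k) = psi M q n (v (Suc k)) + \<gamma> \<cdot>\<^sub>v resid M q n (v k) (s k)"
    by (simp_all add: v_def s_def algA_step_def Let_def)
  \<comment> \<open>The second equation already mentions \<open>v (Suc k)\<close>, so it can be
    folded only after the first.\<close>
  note step = newton_step[OF IH(1-5) sol \<beta> \<eta> \<gamma>, folded eqs(1), folded eqs(2)]
  have "resid M q n (v (Suc k)) (s (Suc k)) = \<gamma> ^ Suc k \<cdot>\<^sub>v resid M q n (v 0) (s 0)"
    unfolding step(6) by (subst IH(6)) (simp add: smult_smult_assoc)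
  moreover have "v (Suc k) \<bullet> s (Suc k) = \<gamma> ^ Suc k * (real n + 1)"
    unfolding step(7) IH(7) by simp
  ultimately show ?case using step(1-5) by blast
qed

text \<open>The assumption makes every entry of the residual nonnegative, so its Euclidean norm is
  at most the sum of its entries, which is n + 1 because e is orthogonal to psi(e).\<close>

lemma vnorm_initial_resid_le:
  assumes le: "\<And>i. i < n + 1 \<Longrightarrow> psi M q n (ones (n + 1)) $ i \<le> 1"
  shows "vnorm (resid M q n (ones (n + 1)) (ones (n + 1))) \<le> real n + 1"
proof -
  let ?p = "psi M q n (ones (n + 1))"
  have "ones (n + 1) \<bullet> ?p = 0"
    by (rule scalar_prod_psi_self) (auto simp: ones_def)
  then have sum0: "(\<Sum>i<n+1. ?p $ i) = 0"
    unfolding scalar_prod_sum[OF psi_dim] by (simp add: ones_def)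
  have "(\<Sum>i<n+1. (1 - ?p $ i)\<^sup>2) \<le> (\<Sum>i<n+1. 1 - ?p $ i)\<^sup>2"
    using le by (intro sum_power2_le_power2_sum) auto
  also have "(\<Sum>i<n+1. 1 - ?p $ i) = real n + 1"
    unfolding sum_subtractf sum0 by simp
  finally have "sqrt (\<Sum>i<n+1. (1 - ?p $ i)\<^sup>2) \<le> real n + 1"
    by (intro real_le_lsqrt) auto
  moreover have "vnorm (resid M q n (ones (n + 1)) (ones (n + 1))) = sqrt (\<Sum>i<n+1. (1 - ?p $ i)\<^sup>2)"
    unfolding vnorm_def resid_def
    by (subst scalar_prod_sum[of _ "n + 1"])
      (auto simp: ones_def power2_eq_square intro!: sum.cong arg_cong[of _ _ sqrt])
  ultimately show ?thesis by simp
qed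

end

text \<open>At e the last coordinate is 1, and the unscaled \<open>psi\<close> has as entries
  exactly the numbers over which \<open>scale_sigma\<close> takes its maximum. Since
  \<open>psi\<close> is linear in the data, scaling divides them by \<sigma>.\<close>

lemma scaled_psi_ones_le_one:
  fixes M :: "real mat" and q :: "real vec" and n :: nat
  assumes M: "M \<in> carrier_mat n n" and q: "q \<in> carrier_vec n" and i: "i < n + 1"
  defines "\<sigma> \<equiv> scale_sigma M q n"
  shows "psi ((1 / \<sigma>) \<cdot>\<^sub>m M) ((1 / \<sigma>) \<cdot>\<^sub>v q) n (ones (n + 1)) $ i \<le> 1"
proof -
  have \<sigma>: "\<sigma> \<ge> 1" and last: "- (ones n \<bullet> (M *\<^sub>v ones n)) - ones n \<bullet> q \<le> \<sigma>"
    by (simp_all add: \<sigma>_def scale_sigma_def)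
  have e: "ones n \<in> carrier_vec n" "xpart n (ones (n + 1)) = ones n"
    by (auto simp: ones_def xpart_def)
  have Me: "M *\<^sub>v ones n \<in> carrier_vec n" using M e by simp
  have sM: "((1 / \<sigma>) \<cdot>\<^sub>m M) *\<^sub>v ones n = (1 / \<sigma>) \<cdot>\<^sub>v (M *\<^sub>v ones n)"
    by (rule smult_mat_mult_vec[OF M e(1)])
  have dims: "dim_vec (M *\<^sub>v ones n) = n" "dim_vec q = n" using M q by auto
  have e1: "ones (n + 1) $ n = 1" by (simp add: ones_def)
  show ?thesis
  proof (cases "i = n")
    case True
    have "psi ((1 / \<sigma>) \<cdot>\<^sub>m M) ((1 / \<sigma>) \<cdot>\<^sub>v q) n (ones (n + 1)) $ i =
        (- (ones n \<bullet> (M *\<^sub>v ones n)) - ones n \<bullet> q) / \<sigma>"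
      unfolding True psi_def Let_def taupart_def e sM
      using dims Me q e e1 by (simp add: diff_divide_distrib)
    then show ?thesis using last \<sigma> by simp
  next
    case False
    with i have i: "i < n" by simp
    have "(M *\<^sub>v ones n + q) $ i \<le> Max {(M *\<^sub>v ones n + q) $ i | i. i < n}"
      using i by (intro Max_ge) auto
    then have "(M *\<^sub>v ones n + q) $ i \<le> \<sigma>" by (simp add: \<sigma>_def scale_sigma_def)
    moreover have "psi ((1 / \<sigma>) \<cdot>\<^sub>m M) ((1 / \<sigma>) \<cdot>\<^sub>v q) n (ones (n + 1)) $ i = (M *\<^sub>v ones n + q) $ i / \<sigma>"
      unfolding psi_def Let_def taupart_def e sM
      using i dims e1 by (simp add: add_divide_distrib del: index_mult_mat_vec)
    ultimately show ?thesis using \<sigma> by simp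
  qed
qed

section \<open>Iteration count and conclusion\<close>

lemma power_nat_ceiling_log_le:
  fixes \<gamma> \<epsilon> m :: real
  assumes "0 < \<gamma>" "\<gamma> < 1" "0 < \<epsilon>" "0 < m"
  shows "\<gamma> ^ nat \<lceil>ln (m / \<epsilon>) / (- ln \<gamma>)\<rceil> * m \<le> \<epsilon>"
proof -
  let ?N = "nat \<lceil>ln (m / \<epsilon>) / (- ln \<gamma>)\<rceil>"
  have "ln \<gamma> < 0" using assms by simp
  \<comment> \<open>Both the ceiling and the truncation by \<open>nat\<close> can only increase the
    value.\<close>
  moreover have "ln (m / \<epsilon>) / (- ln \<gamma>) \<le> real ?N" by linarith
  ultimately have "ln (m / \<epsilon>) \<le> - (real ?N * ln \<gamma>)"
    by (simp add: field_simps)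
  then have "ln (\<gamma> ^ ?N * m) \<le> ln \<epsilon>"
    using assms by (simp add: ln_mult ln_div ln_realpow)
  then show ?thesis using assms by (subst (asm) ln_le_cancel_iff) auto
qed

text \<open>Well-definedness is expressed by the first conjunct: before each of the \<open>N\<close>
  steps the Newton system has exactly one solution, so the \<open>THE\<close> in
  \<open>algA_step\<close> is meaningful.\<close>

theorem theorem1:
  fixes Q A :: "real mat" and c b :: "real vec" and nz nb :: nat and \<epsilon> :: real
  assumes "Q \<in> carrier_mat nz nz" and "Q\<^sup>T = Q"
    and "\<forall>v \<in> carrier_vec nz. v \<bullet> (Q *\<^sub>v v) \<ge> 0"
    and "A \<in> carrier_mat nb nz" and "c \<in> carrier_vec nz" and "b \<in> carrier_vec nb"
    and "nz + nb \<ge> 1"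
    and "0 < \<epsilon>" and "\<epsilon> \<le> real (nz + nb) + 1"
  shows
    "let n = nz + nb;
         \<beta> = (0.414213 :: real);
         \<eta> = \<beta> / sqrt (real n + 1);
         \<gamma> = 1 - \<eta>;
         N = nat \<lceil>ln ((real n + 1) / \<epsilon>) / (- ln (1 - 0.414213 / sqrt (real n + 1)))\<rceil>;
         M = lcp_M Q A nb; q = lcp_q c b; \<sigma> = scale_sigma M q n;
         Mp = (1 / \<sigma>) \<cdot>\<^sub>m M; qp = (1 / \<sigma>) \<cdot>\<^sub>v q;
         xk = (\<lambda>k. fst (algA_iter Mp qp n \<eta> \<gamma> k));
         sk = (\<lambda>k. snd (algA_iter Mp qp n \<eta> \<gamma> k));
         rk = (\<lambda>k. resid Mp qp n (xk k) (sk k));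
         muk = (\<lambda>k. mu_bar n (xk k) (sk k))
     in (\<forall>k < N. \<exists>!d. newton_sol Mp qp n \<eta> \<gamma> (xk k) (sk k) d) \<and>
        (\<forall>k \<le> N.
           xk k \<in> carrier_vec (n + 1) \<and> sk k \<in> carrier_vec (n + 1) \<and>
           pos_vec (xk k) \<and> pos_vec (sk k) \<and>
           vnorm (hadamard (xk k) (sk k) - muk k \<cdot>\<^sub>v ones (n + 1)) \<le> \<beta> * muk k \<and>
           rk k = (1 - \<eta>) ^ k \<cdot>\<^sub>v rk 0 \<and>
           xk k \<bullet> sk k = (1 - \<eta>) ^ k * (real n + 1)) \<and>
        vnorm (rk N) \<le> \<epsilon> \<and> xk N \<bullet> sk N \<le> \<epsilon>"
proof -
  define n where "n = nz + nb"
  define \<beta> where "\<beta> = (0.414213 :: real)"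
  define \<eta> where "\<eta> = \<beta> / sqrt (real n + 1)"
  define \<gamma> where "\<gamma> = 1 - \<eta>"
  define N where "N = nat \<lceil>ln ((real n + 1) / \<epsilon>) / (- ln (1 - 0.414213 / sqrt (real n + 1)))\<rceil>"
  define M where "M = lcp_M Q A nb"
  define q where "q = lcp_q c b"
  define \<sigma> where "\<sigma> = scale_sigma M q n"
  define Mp where "Mp = (1 / \<sigma>) \<cdot>\<^sub>m M"
  define qp where "qp = (1 / \<sigma>) \<cdot>\<^sub>v q"
  define v where "v = (\<lambda>k. fst (algA_iter Mp qp n \<eta> \<gamma> k))"
  define s where "s = (\<lambda>k. snd (algA_iter Mp qp n \<eta> \<gamma> k))"
  have \<sigma>: "\<sigma> \<ge> 1" by (simp add: \<sigma>_def scale_sigma_def)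
  interpret monotone_lcp Mp qp n
    unfolding Mp_def qp_def M_def q_def n_def
    by (rule monotone_lcp_scaled_lcp_M) (use assms \<sigma> in auto)
  have M: "M \<in> carrier_mat n n"
    unfolding M_def lcp_M_def n_def by (rule four_block_carrier_mat) (use assms in auto)
  have q: "q \<in> carrier_vec n" using assms by (auto simp: q_def lcp_q_def n_def)
  \<comment> \<open>The constant is \<surd>2 - 1 cut off after six decimals, so the third inequality
    is strict by a narrow margin.\<close>
  have \<beta>: "0 < \<beta>" "\<beta> < 1" "2 * \<beta>\<^sup>2 < (1 - \<beta>)\<^sup>2" by (simp_all add: \<beta>_def power2_eq_square)
  have \<eta>: "\<eta>\<^sup>2 * (real n + 1) = \<beta>\<^sup>2" by (simp add: \<eta>_def power_divide)
  have \<eta>_pos: "0 < \<eta>" using \<beta> by (simp add: \<eta>_def)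
  \<comment> \<open>From this \<eta> \<le> \<beta> < 1/2, which gives the lower bound on
    \<gamma>.\<close>
  have "sqrt (real n + 1) \<ge> 1" by simp
  then have "\<eta> \<le> \<beta> / 1" unfolding \<eta>_def using \<beta> by (intro divide_left_mono) auto
  then have \<gamma>: "\<gamma> = 1 - \<eta>" "\<gamma> \<ge> 1 / 2" by (simp_all add: \<gamma>_def \<beta>_def)
  have inv: "v k \<in> carrier_vec (n + 1) \<and> s k \<in> carrier_vec (n + 1) \<and> pos_vec (v k) \<and> pos_vec (s k) \<and>
    vnorm (hadamard (v k) (s k) - mu_bar n (v k) (s k) \<cdot>\<^sub>v ones (n + 1)) \<le> \<beta> * mu_bar n (v k) (s k) \<and>
    resid Mp qp n (v k) (s k) = \<gamma> ^ k \<cdot>\<^sub>v resid Mp qp n (v 0) (s 0) \<and>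
    v k \<bullet> s k = \<gamma> ^ k * (real n + 1)" for k
    unfolding v_def s_def by (rule algA_iter_invariant[OF \<beta> \<eta> \<gamma>])
  have ex1: "\<exists>!d. newton_sol Mp qp n \<eta> \<gamma> (v k) (s k) d" for k
    using inv[of k] by (intro newton_sol_ex1) auto
  have \<gamma>N: "\<gamma> ^ N * (real n + 1) \<le> \<epsilon>"
    using power_nat_ceiling_log_le[of \<gamma> \<epsilon> "real n + 1"] \<gamma> \<eta>_pos assms
    by (simp add: N_def \<gamma>_def \<eta>_def \<beta>_def)
  have r0: "vnorm (resid Mp qp n (v 0) (s 0)) \<le> real n + 1"
    using vnorm_initial_resid_le scaled_psi_ones_le_one[OF M q]
    by (simp add: v_def s_def Mp_def qp_def \<sigma>_def)
  have "vnorm (resid Mp qp n (v N) (s N)) = \<gamma> ^ N * vnorm (resid Mp qp n (v 0) (s 0))"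
    using inv[of N] \<gamma> by (simp add: vnorm_def real_sqrt_mult)
  also have "\<dots> \<le> \<gamma> ^ N * (real n + 1)"
    using r0 \<gamma> by (intro mult_left_mono) auto
  finally have rN: "vnorm (resid Mp qp n (v N) (s N)) \<le> \<epsilon>" using \<gamma>N by linarith
  have main: "(\<forall>k < N. \<exists>!d. newton_sol Mp qp n \<eta> \<gamma> (v k) (s k) d) \<and>
        (\<forall>k \<le> N.
           v k \<in> carrier_vec (n + 1) \<and> s k \<in> carrier_vec (n + 1) \<and>
           pos_vec (v k) \<and> pos_vec (s k) \<and>
           vnorm (hadamard (v k) (s k) - mu_bar n (v k) (s k) \<cdot>\<^sub>v ones (n + 1)) \<le> \<beta> * mu_bar n (v k) (s k) \<and>
           resid Mp qp n (v k) (s k) = (1 - \<eta>) ^ k \<cdot>\<^sub>v resid Mp qp n (v 0) (s 0) \<and>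
           v k \<bullet> s k = (1 - \<eta>) ^ k * (real n + 1)) \<and>
        vnorm (resid Mp qp n (v N) (s N)) \<le> \<epsilon> \<and> v N \<bullet> s N \<le> \<epsilon>"
    unfolding \<gamma>_def[symmetric] using ex1 inv rN \<gamma>N conjunct2[OF inv[of N]]
    by (intro conjI allI impI) metis+
  show ?thesis
    unfolding Let_def
    using main unfolding v_def s_def Mp_def qp_def \<sigma>_def M_def q_def N_def \<gamma>_def \<eta>_def \<beta>_def n_def .
qed

end
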